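(* Let $\mathcal{K}$ be a unital associative algebra over $\mathbb{C}$ (not necessarily commutative), let $M$ be an $n\times m$ Manin matrix over $\mathcal{K}$ and let $Y$ be an $m\times s$ matrix over $\mathcal{K}$ (not necessarily Manin). Let $\psi_1,\dots,\psi_n$ be Grassmann variables commuting with $\mathcal{K}$, and put $\psi^M_i=\sum_{k=1}^n\psi_kM_{ki}\in\mathcal{K}\otimes\Lambda[\psi_1,\dots,\psi_n]$ for $1\le i\le m$. Assume there is an $n\times s$ matrix $Q$ over $\mathcal{K}$ such that the elements $\psi^Q_j=\sum_{k=1}^n\psi_kQ_{kj}$ ($1\le j\le s$) satisfy the following two conditions. Condition 1: for all $1\le p\le m$ and $1\le j\le s$, $$\sum_{l=1}^m\psi^M_l\,[Y_{lj},\psi^M_p]=\psi^M_p\,\psi^Q_j .$$ Condition 2: for all $1\le i\le m$ and $1\le j\le s$, $\ \psi^M_i\psi^Q_j=-\psi^Q_j\psi^M_i$. Then: (a) If $n=m=s$, then $$\det{}^{col}\bigl(MY+Q\,\mathrm{diag}(n-1,n-2,\dots,1,0)\bigr)=\det{}^{col}(M)\,\det{}^{col}(Y).$$ (b) More generally, for arbitrary $n,m,s$, let $r\le n$, $r\le s$, and let $I=(i_1<i_2<\dots<i_r)$ and $J=(j_1,\dots,j_r)$ be multi-indices with $1\le i_a\le n$ and $1\le j_a\le s$ ($J$ is not required to be increasing nor to have distinct entries). Then $$\det{}^{col}\bigl((MY)_{IJ}+Q_{IJ}\,\mathrm{diag}(r-1,r-2,\dots,1,0)\bigr)=\sum_{L=(l_1<l_2<\dots<l_r),\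 1\le l_a\le m}\det{}^{col}(M_{IL})\,\det{}^{col}(Y_{LJ}).$$
   Context: A (possibly rectangular) matrix $M=(M_{ij})$ with entries in an associative ring $\mathcal{K}$ is called a Manin matrix if (1) entries lying in the same column commute with each other, and (2) $[M_{ij},M_{kl}]=[M_{kj},M_{il}]$ for all $i,j,k,l$, where $[a,b]=ab-ba$. $\Lambda[\psi_1,\dots,\psi_n]$ is the Grassmann algebra over $\mathbb{C}$: $\psi_i^2=0$, $\psi_i\psi_j=-\psi_j\psi_i$; in $\mathcal{K}\otimes\Lambda[\psi_1,\dots,\psi_n]$ the $\psi_i$ commute with all elements of $\mathcal{K}$, and $[x,y]=xy-yx$. For any $r\times r$ matrix $X$ over $\mathcal{K}$, $\det^{col}(X)=\sum_{\sigma\in S_r}\operatorname{sgn}(\sigma)\,X_{\sigma(1)1}X_{\sigma(2)2}\cdots X_{\sigma(r)r}$. For a matrix $A$ and multi-indices $I=(i_1,\dots,i_r)$, $J=(j_1,\dots,j_r)$, $A_{IJ}$ is the $r\times r$ matrix with $(A_{IJ})_{ab}=A_{i_aj_b}$. $\mathrm{diag}(a_1,a_2,\dots)$ is the diagonal matrix with the indicated diagonal entries. *)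

theory Defs
  imports
    Complex_Main
    "HOL-Combinatorics.Permutations"
    "Jordan_Normal_Form.Matrix"
begin

section \<open>Unital associative algebras over the complex numbers\<close>

text \<open>
  The class extends \<^class>\<open>ring\<close> and \<^class>\<open>monoid_mult\<close> rather than \<^class>\<open>ring_1\<close>, because
  \<^class>\<open>ring_1\<close> demands \<open>0 \<noteq> 1\<close> and would exclude the zero algebra.
\<close>

class complex_algebra_1 = ring + monoid_mult +
  fixes scaleC :: "complex \<Rightarrow> 'a \<Rightarrow> 'a" (infixr \<open>*\<^sub>C\<close> 75)
  assumes scaleC_add_right: "c *\<^sub>C (x + y) = c *\<^sub>C x + c *\<^sub>C y"
    and scaleC_add_left: "(c + d) *\<^sub>C x = c *\<^sub>C x + d *\<^sub>C x"
    and scaleC_scaleC: "c *\<^sub>C d *\<^sub>C x = (c * d) *\<^sub>C x"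
    and scaleC_one: "1 *\<^sub>C x = x"
    and mult_scaleC_left: "(c *\<^sub>C x) * y = c *\<^sub>C (x * y)"
    and mult_scaleC_right: "x * (c *\<^sub>C y) = c *\<^sub>C (x * y)"
begin

lemma scaleC_zero_right [simp]: "c *\<^sub>C 0 = 0"
  using scaleC_add_right[of c 0 0] by simp

lemma scaleC_zero_left [simp]: "0 *\<^sub>C x = 0"
  using scaleC_add_left[of 0 0 x] by simp

lemma scaleC_minus_one: "(- 1) *\<^sub>C x = - x"
proof -
  have "x + (- 1) *\<^sub>C x = 0"
    using scaleC_add_left[of 1 "- 1" x] by (simp add: scaleC_one)
  then show ?thesis by (simp add: add_eq_0_iff)
qed

lemma scaleC_sum_right: "c *\<^sub>C (\<Sum>i\<in>A. f i) = (\<Sum>i\<in>A. c *\<^sub>C f i)"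
  by (induction A rule: infinite_finite_induct) (simp_all add: scaleC_add_right)

end

definition commutator :: "'a::ring \<Rightarrow> 'a \<Rightarrow> 'a" where
  "commutator a b = a * b - b * a"


section \<open>Grassmann variables over an algebra\<close>

text \<open>
  Elements of \<open>K \<otimes> \<Lambda>[\<psi>\<^sub>0, \<psi>\<^sub>1, \<dots>]\<close> are represented by their coefficients with respect to the
  monomials \<open>\<psi>\<^sub>S = \<psi>\<^sub>a \<psi>\<^sub>b \<dots>\<close> for \<open>S = {a < b < \<dots>}\<close>, where \<open>S\<close> runs over the finite sets of indices.
  The algebra \<open>K \<otimes> \<Lambda>[\<psi>\<^sub>0, \<dots>, \<psi>\<^sub>n\<^sub>-\<^sub>1]\<close> is the subalgebra of the elements supported on
  subsets of \<open>{..<n}\<close>, so an equation between such elements means the same in both algebras.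
\<close>

typedef (overloaded) 'a grassmann =
  "{f :: nat set \<Rightarrow> 'a::zero. finite {S. f S \<noteq> 0} \<and> (\<forall>S. infinite S \<longrightarrow> f S = 0)}"
  morphisms gcoeff Abs_grassmann
  by (rule exI[of _ "\<lambda>_. 0"]) simp

setup_lifting type_definition_grassmann

lemma grassmann_eqI:
  assumes "\<And>S. finite S \<Longrightarrow> gcoeff x S = gcoeff y S"
  shows "x = y"
proof -
  have "gcoeff x S = gcoeff y S" for S
    using assms[of S] gcoeff[of x] gcoeff[of y] by (cases "finite S") auto
  then show ?thesis by (simp add: gcoeff_inject[symmetric] fun_eq_iff)
qed

lemma gcoeff_infinite: "infinite S \<Longrightarrow> gcoeff x S = 0"
  using gcoeff[of x] by simp

text \<open>
  For disjoint \<open>A\<close> and \<open>B\<close> one has \<open>\<psi>\<^sub>A \<psi>\<^sub>B = gsign A B \<cdot> \<psi>\<^sub>A\<^sub>\<union>\<^sub>B\<close>: the exponent counts the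
  transpositions that sort the concatenation. If \<open>A\<close> and \<open>B\<close> meet, \<open>\<psi>\<^sub>A \<psi>\<^sub>B = 0\<close>.
\<close>

definition gsign :: "nat set \<Rightarrow> nat set \<Rightarrow> complex" where
  "gsign A B = (- 1) ^ card {(a, b). a \<in> A \<and> b \<in> B \<and> b < a}"

lemma gsign_empty [simp]: "gsign {} B = 1" "gsign A {} = 1"
  by (simp_all add: gsign_def)

lemma gsign_sorted:
  assumes "\<And>a b. a \<in> A \<Longrightarrow> b \<in> B \<Longrightarrow> a \<le> b"
  shows "gsign A B = 1"
proof -
  have "{(a, b). a \<in> A \<and> b \<in> B \<and> b < a} = {}" using assms by force
  then show ?thesis by (simp only: gsign_def card.empty power_0)
qed

lemma gsign_singletons: "gsign {k} {l} = (if l < k then - 1 else 1)"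
proof (cases "l < k")
  case True
  then have "{(a, b). a \<in> {k} \<and> b \<in> {l} \<and> b < a} = {(k, l)}" by auto
  then have "gsign {k} {l} = (- 1) ^ card {(k, l)}" by (simp only: gsign_def)
  then show ?thesis using True by simp
qed (use gsign_sorted[of "{k}" "{l}"] in auto)

lemma gsign_Un_left:
  assumes "finite A" "finite A'" "finite B" "A \<inter> A' = {}"
  shows "gsign (A \<union> A') B = gsign A B * gsign A' B"
proof -
  let ?X = "\<lambda>A. {(a, b). a \<in> A \<and> b \<in> B \<and> b < a}"
  have fin: "finite (?X A)" if "finite A" for A
    by (rule finite_subset[of _ "A \<times> B"]) (use that assms in auto)
  have "?X (A \<union> A') = ?X A \<union> ?X A'" by auto
  moreover have "?X A \<inter> ?X A' = {}" using assms by auto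
  ultimately show ?thesis
    using fin assms by (simp add: gsign_def card_Un_disjoint power_add)
qed

lemma gsign_Un_right:
  assumes "finite A" "finite B" "finite B'" "B \<inter> B' = {}"
  shows "gsign A (B \<union> B') = gsign A B * gsign A B'"
proof -
  let ?X = "\<lambda>B. {(a, b). a \<in> A \<and> b \<in> B \<and> b < a}"
  have fin: "finite (?X B)" if "finite B" for B
    by (rule finite_subset[of _ "A \<times> B"]) (use that assms in auto)
  have "?X (B \<union> B') = ?X B \<union> ?X B'" by auto
  moreover have "?X B \<inter> ?X B' = {}" using assms by auto
  ultimately show ?thesis
    using fin assms by (simp add: gsign_def card_Un_disjoint power_add)
qed

instantiation grassmann :: (ab_group_add) ab_group_add
begin

lift_definition zero_grassmann :: "'a grassmann" is "\<lambda>_. 0" by simp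

lift_definition plus_grassmann :: "'a grassmann \<Rightarrow> 'a grassmann \<Rightarrow> 'a grassmann"
  is "\<lambda>f g S. f S + g S"
proof -
  fix f g :: "nat set \<Rightarrow> 'a"
  assume f: "finite {S. f S \<noteq> 0} \<and> (\<forall>S. infinite S \<longrightarrow> f S = 0)"
    and g: "finite {S. g S \<noteq> 0} \<and> (\<forall>S. infinite S \<longrightarrow> g S = 0)"
  have "finite {S. f S + g S \<noteq> 0}"
    by (rule finite_subset[of _ "{S. f S \<noteq> 0} \<union> {S. g S \<noteq> 0}"]) (use f g in auto)
  then show "finite {S. f S + g S \<noteq> 0} \<and> (\<forall>S. infinite S \<longrightarrow> f S + g S = 0)"
    using f g by simp
qed

lift_definition uminus_grassmann :: "'a grassmann \<Rightarrow> 'a grassmann"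
  is "\<lambda>f S. - f S" by simp

definition minus_grassmann :: "'a grassmann \<Rightarrow> 'a grassmann \<Rightarrow> 'a grassmann" where
  "minus_grassmann x y = x + - y"

lemma gcoeff_zero [simp]: "gcoeff 0 S = 0"
  by transfer simp

lemma gcoeff_add [simp]: "gcoeff (x + y) S = gcoeff x S + gcoeff y S"
  by transfer simp

lemma gcoeff_uminus [simp]: "gcoeff (- x) S = - gcoeff x S"
  by transfer simp

instance
  by standard (auto intro!: grassmann_eqI simp: minus_grassmann_def add_ac)

end

lemma gcoeff_sum [simp]: "gcoeff (\<Sum>i\<in>A. f i) S = (\<Sum>i\<in>A. gcoeff (f i) S)"
  by (induction A rule: infinite_finite_induct) simp_all

instantiation grassmann :: (complex_algebra_1) complex_algebra_1
begin

lift_definition one_grassmann :: "'a grassmann" is "\<lambda>S. if S = {} then 1 else 0"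
  by auto

lift_definition times_grassmann :: "'a grassmann \<Rightarrow> 'a grassmann \<Rightarrow> 'a grassmann"
  is "\<lambda>f g S. \<Sum>A\<in>Pow S. gsign A (S - A) *\<^sub>C (f A * g (S - A))"
proof -
  fix f g :: "nat set \<Rightarrow> 'a"
  let ?h = "\<lambda>S. \<Sum>A\<in>Pow S. gsign A (S - A) *\<^sub>C (f A * g (S - A))"
  assume f: "finite {S. f S \<noteq> 0} \<and> (\<forall>S. infinite S \<longrightarrow> f S = 0)"
    and g: "finite {S. g S \<noteq> 0} \<and> (\<forall>S. infinite S \<longrightarrow> g S = 0)"
  have "{S. ?h S \<noteq> 0} \<subseteq> (\<lambda>(A, B). A \<union> B) ` ({S. f S \<noteq> 0} \<times> {S. g S \<noteq> 0})"
  proof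
    fix S assume "S \<in> {S. ?h S \<noteq> 0}"
    then obtain A where A: "A \<in> Pow S" "gsign A (S - A) *\<^sub>C (f A * g (S - A)) \<noteq> 0"
      by (metis (mono_tags, lifting) mem_Collect_eq sum.neutral)
    then have "f A \<noteq> 0" "g (S - A) \<noteq> 0" by auto
    moreover have "S = A \<union> (S - A)" using A by auto
    ultimately show "S \<in> (\<lambda>(A, B). A \<union> B) ` ({S. f S \<noteq> 0} \<times> {S. g S \<noteq> 0})"
      by (metis (mono_tags, lifting) SigmaI image_eqI mem_Collect_eq split_conv)
  qed
  with f g have "finite {S. ?h S \<noteq> 0}"
    using finite_subset by blast
  then show "finite {S. ?h S \<noteq> 0} \<and> (\<forall>S. infinite S \<longrightarrow> ?h S = 0)"
    by simp
qed

lift_definition scaleC_grassmann :: "complex \<Rightarrow> 'a grassmann \<Rightarrow> 'a grassmann"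
  is "\<lambda>c f S. c *\<^sub>C f S"
proof -
  fix c and f :: "nat set \<Rightarrow> 'a"
  assume f: "finite {S. f S \<noteq> 0} \<and> (\<forall>S. infinite S \<longrightarrow> f S = 0)"
  have "finite {S. c *\<^sub>C f S \<noteq> 0}"
    by (rule finite_subset[of _ "{S. f S \<noteq> 0}"]) (use f in auto)
  then show "finite {S. c *\<^sub>C f S \<noteq> 0} \<and> (\<forall>S. infinite S \<longrightarrow> c *\<^sub>C f S = 0)"
    using f by simp
qed

lemma gcoeff_one: "gcoeff 1 S = (if S = {} then 1 else 0)"
  by transfer simp

lemma gcoeff_times:
  "gcoeff (x * y) S = (\<Sum>A\<in>Pow S. gsign A (S - A) *\<^sub>C (gcoeff x A * gcoeff y (S - A)))"
  by transfer simp

lemma gcoeff_scaleC [simp]: "gcoeff (c *\<^sub>C x) S = c *\<^sub>C gcoeff x S"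
  by transfer simp

instance
proof
  fix x y z :: "'a grassmann" and c d :: complex
  show "x * y * z = x * (y * z)"
  proof (rule grassmann_eqI)
    fix S :: "nat set"
    assume S: "finite S"
    note fin = finite_subset[OF _ S]
    define t where "t A B = (gsign A (S - A) * gsign B (A - B)) *\<^sub>C
      (gcoeff x B * gcoeff y (A - B) * gcoeff z (S - A))" for A B
    define u where "u B C = (gsign B (S - B) * gsign C (S - B - C)) *\<^sub>C
      (gcoeff x B * gcoeff y C * gcoeff z (S - B - C))" for B C
    have "gcoeff (x * y * z) S = (\<Sum>A\<in>Pow S. \<Sum>B\<in>Pow A. t A B)"
      by (simp add: gcoeff_times t_def sum_distrib_right scaleC_sum_right mult_scaleC_left
          scaleC_scaleC)
    also have "\<dots> = (\<Sum>(A, B)\<in>(SIGMA A:Pow S. Pow A). t A B)"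
      using S fin by (subst sum.Sigma) auto
    also have "\<dots> = (\<Sum>(B, C)\<in>(SIGMA B:Pow S. Pow (S - B)). u B C)"
    proof (rule sum.reindex_bij_witness[where i = "\<lambda>(B, C). (B \<union> C, B)"
          and j = "\<lambda>(A, B). (B, A - B)"], goal_cases)
      case (5 p)
      then obtain A B where p: "p = (A, B)" "B \<subseteq> A" "A \<subseteq> S" by auto
      have f: "finite A" "finite B" "finite (S - A)" "finite (A - B)"
        using p S fin by (auto intro: finite_subset)
      have e: "S - B - (A - B) = S - A" using p by auto
      have "gsign A (S - A) = gsign B (S - A) * gsign (A - B) (S - A)"
        using gsign_Un_left[of B "A - B" "S - A"] f p
        by (simp add: Un_absorb1)
      moreover have "gsign B (S - B) = gsign B (A - B) * gsign B (S - A)"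
      proof -
        have "S - B = (A - B) \<union> (S - A)" using p by auto
        then show ?thesis using gsign_Un_right[of B "A - B" "S - A"] f by auto
      qed
      ultimately show ?case by (simp add: p t_def u_def e mult_ac)
    qed auto
    also have "\<dots> = (\<Sum>B\<in>Pow S. \<Sum>C\<in>Pow (S - B). u B C)"
      using S by (subst sum.Sigma) auto
    also have "\<dots> = gcoeff (x * (y * z)) S"
      by (simp add: gcoeff_times u_def sum_distrib_left scaleC_sum_right mult_scaleC_right
          scaleC_scaleC mult.assoc)
    finally show "gcoeff (x * y * z) S = gcoeff (x * (y * z)) S" .
  qed
  show "1 * x = x"
  proof (rule grassmann_eqI)
    fix S :: "nat set" assume S: "finite S"
    have "gcoeff (1 * x) S = (\<Sum>A\<in>Pow S. if A = {} then gcoeff x S else 0)"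
      unfolding gcoeff_times by (rule sum.cong) (auto simp: gcoeff_one scaleC_one)
    then show "gcoeff (1 * x) S = gcoeff x S" using S by simp
  qed
  show "x * 1 = x"
  proof (rule grassmann_eqI)
    fix S :: "nat set" assume S: "finite S"
    have "gcoeff (x * 1) S = (\<Sum>A\<in>Pow S. if A = S then gcoeff x S else 0)"
      unfolding gcoeff_times by (rule sum.cong) (auto simp: gcoeff_one scaleC_one)
    then show "gcoeff (x * 1) S = gcoeff x S" using S by simp
  qed
  show "(x + y) * z = x * z + y * z"
    by (rule grassmann_eqI)
      (simp add: gcoeff_times algebra_simps scaleC_add_right sum.distrib)
  show "x * (y + z) = x * y + x * z"
    by (rule grassmann_eqI)
      (simp add: gcoeff_times algebra_simps scaleC_add_right sum.distrib)
  show "c *\<^sub>C (x + y) = c *\<^sub>C x + c *\<^sub>C y"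
    by (rule grassmann_eqI) (simp add: scaleC_add_right)
  show "(c + d) *\<^sub>C x = c *\<^sub>C x + d *\<^sub>C x"
    by (rule grassmann_eqI) (simp add: scaleC_add_left)
  show "c *\<^sub>C d *\<^sub>C x = (c * d) *\<^sub>C x"
    by (rule grassmann_eqI) (simp add: scaleC_scaleC)
  show "1 *\<^sub>C x = x"
    by (rule grassmann_eqI) (simp add: scaleC_one)
  show "(c *\<^sub>C x) * y = c *\<^sub>C (x * y)"
    by (rule grassmann_eqI)
      (simp add: gcoeff_times scaleC_sum_right mult_scaleC_left scaleC_scaleC mult.commute)
  show "x * (c *\<^sub>C y) = c *\<^sub>C (x * y)"
    by (rule grassmann_eqI)
      (simp add: gcoeff_times scaleC_sum_right mult_scaleC_right scaleC_scaleC mult.commute)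
qed

end

lift_definition gmonom :: "'a::zero \<Rightarrow> nat set \<Rightarrow> 'a grassmann"
  is "\<lambda>c S T. if T = S \<and> finite S then c else 0"
proof -
  fix c :: 'a and S :: "nat set"
  show "finite {T. (if T = S \<and> finite S then c else 0) \<noteq> 0} \<and>
    (\<forall>T. infinite T \<longrightarrow> (if T = S \<and> finite S then c else 0) = 0)"
    using finite_subset[of "{T. (if T = S \<and> finite S then c else 0) \<noteq> 0}" "{S}"] by auto
qed

definition gconst :: "'a::zero \<Rightarrow> 'a grassmann" where
  "gconst c = gmonom c {}"

definition psi :: "nat \<Rightarrow> 'a::complex_algebra_1 grassmann" where
  "psi k = gmonom 1 {k}"

lemma gcoeff_gmonom: "gcoeff (gmonom c S) T = (if T = S \<and> finite S then c else 0)"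
  by transfer simp

text \<open>
  The defining relations, and the freeness of \<open>K \<otimes> \<Lambda>\<close> as a \<open>K\<close>-module on the ordered monomials.
\<close>

lemma gmonom_times:
  fixes c d :: "'a::complex_algebra_1"
  assumes "finite A" "finite B"
  shows "gmonom c A * gmonom d B =
    (if A \<inter> B = {} then gsign A B *\<^sub>C gmonom (c * d) (A \<union> B) else 0)"
proof (rule grassmann_eqI)
  fix S :: "nat set" assume S: "finite S"
  have eq: "gsign X (S - X) *\<^sub>C (gcoeff (gmonom c A) X * gcoeff (gmonom d B) (S - X)) =
      (if X = A then if S - A = B then gsign A B *\<^sub>C (c * d) else 0 else 0)" for X
    using assms by (auto simp: gcoeff_gmonom)
  have "gcoeff (gmonom c A * gmonom d B) S =
      (if A \<subseteq> S \<and> S - A = B then gsign A B *\<^sub>C (c * d) else 0)"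
    unfolding gcoeff_times eq using S by simp
  also have "A \<subseteq> S \<and> S - A = B \<longleftrightarrow> A \<inter> B = {} \<and> S = A \<union> B" by auto
  finally show "gcoeff (gmonom c A * gmonom d B) S = gcoeff
      (if A \<inter> B = {} then gsign A B *\<^sub>C gmonom (c * d) (A \<union> B) else 0) S"
    using assms by (simp add: gcoeff_gmonom)
qed

lemma gconst_one: "gconst 1 = 1"
  by (rule grassmann_eqI) (simp add: gconst_def gcoeff_gmonom gcoeff_one)

lemma gconst_add: "gconst (a + b) = gconst a + gconst b" for a b :: "'a::ab_group_add"
  by (rule grassmann_eqI) (simp add: gconst_def gcoeff_gmonom)

lemma gconst_mult: "gconst (a * b) = gconst a * gconst b" for a b :: "'a::complex_algebra_1"
  by (simp add: gconst_def gmonom_times scaleC_one)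

lemma gconst_scaleC: "gconst (c *\<^sub>C a) = c *\<^sub>C gconst a" for a :: "'a::complex_algebra_1"
  by (rule grassmann_eqI) (simp add: gconst_def gcoeff_gmonom)

lemma psi_square: "psi k * psi k = 0"
  by (simp add: psi_def gmonom_times)

lemma psi_anticommute: "psi k * psi l = - (psi l * psi k)"
  by (cases k l rule: linorder_cases)
    (simp_all add: psi_def gmonom_times gsign_singletons scaleC_one scaleC_minus_one insert_commute)

lemma psi_commute_gconst: "psi k * gconst a = gconst a * psi k"
  by (simp add: psi_def gconst_def gmonom_times)

lemma gmonom_eq_prod_psi:
  fixes c :: "'a::complex_algebra_1"
  assumes "finite S"
  shows "gmonom c S = gconst c * prod_list (map psi (sorted_list_of_set S))"
  using assms
proof (induction "card S" arbitrary: S c)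
  case 0
  then show ?case by (simp add: gconst_def)
next
  case (Suc n)
  then have ne: "S \<noteq> {}" by auto
  define k where "k = Min S"
  have k: "k \<in> S" "\<And>l. l \<in> S \<Longrightarrow> k \<le> l" using Suc.prems ne by (simp_all add: k_def)
  have sl: "sorted_list_of_set S = k # sorted_list_of_set (S - {k})"
    using sorted_list_of_set_nonempty[OF Suc.prems ne] by (simp add: k_def)
  have IH: "gmonom c (S - {k}) = gconst c * prod_list (map psi (sorted_list_of_set (S - {k})))"
    using Suc k by (intro Suc.hyps(1)) simp_all
  have e: "gsign {k} (S - {k}) = 1" using k by (intro gsign_sorted) auto
  have "gmonom c S = psi k * gmonom c (S - {k})"
    using Suc.prems k e
    by (simp add: psi_def gmonom_times scaleC_one insert_absorb)
  also have "\<dots> = gconst c * (psi k * prod_list (map psi (sorted_list_of_set (S - {k}))))"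
    by (simp only: IH mult.assoc[symmetric] psi_commute_gconst)
  finally show ?case by (simp add: sl)
qed

lemma grassmann_expansion:
  "x = (\<Sum>S | gcoeff x S \<noteq> 0. gmonom (gcoeff x S) S)" for x :: "'a::ab_group_add grassmann"
proof (rule grassmann_eqI)
  fix T :: "nat set" assume T: "finite T"
  have eq: "gcoeff (gmonom (gcoeff x S) S) T = (if T = S then gcoeff x T else 0)" for S
    using T by (auto simp: gcoeff_gmonom)
  have "finite {S. gcoeff x S \<noteq> 0}" using gcoeff[of x] by simp
  then show "gcoeff x T = gcoeff (\<Sum>S | gcoeff x S \<noteq> 0. gmonom (gcoeff x S) S) T"
    by (simp add: eq)
qed


section \<open>Manin matrices, column determinants and the elements \<open>\<psi>\<^sup>A\<^sub>i\<close>\<close>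

text \<open>All row and column indices start at \<open>0\<close>.\<close>

definition manin_matrix :: "'a::ring mat \<Rightarrow> bool" where
  "manin_matrix M \<longleftrightarrow>
    (\<forall>i < dim_row M. \<forall>k < dim_row M. \<forall>j < dim_col M. M $$ (i, j) * M $$ (k, j) = M $$ (k, j) * M $$ (i, j)) \<and>
    (\<forall>i < dim_row M. \<forall>k < dim_row M. \<forall>j < dim_col M. \<forall>l < dim_col M.
      commutator (M $$ (i, j)) (M $$ (k, l)) = commutator (M $$ (k, j)) (M $$ (i, l)))"

text \<open>Meaningful only for square matrices; the factors are multiplied from left to right by column.\<close>

definition det_col :: "'a::complex_algebra_1 mat \<Rightarrow> 'a" where
  "det_col X = (\<Sum>\<sigma> | \<sigma> permutes {..<dim_row X}.
    of_int (sign \<sigma>) *\<^sub>C prod_list (map (\<lambda>j. X $$ (\<sigma> j, j)) [0..<dim_row X]))"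

definition mat_select :: "'a mat \<Rightarrow> nat list \<Rightarrow> nat list \<Rightarrow> 'a mat" where
  "mat_select A I J = mat (length I) (length J) (\<lambda>(a, b). A $$ (I ! a, J ! b))"

definition desc_diag :: "nat \<Rightarrow> 'a::complex_algebra_1 mat" where
  "desc_diag r = mat_diag r (\<lambda>a. of_nat (r - 1 - a) *\<^sub>C 1)"

definition increasing_indices :: "nat \<Rightarrow> nat \<Rightarrow> nat list set" where
  "increasing_indices m r = {L. length L = r \<and> sorted_wrt (<) L \<and> set L \<subseteq> {..<m}}"

definition psi_mat :: "'a::complex_algebra_1 mat \<Rightarrow> nat \<Rightarrow> 'a grassmann" where
  "psi_mat A i = (\<Sum>k<dim_row A. psi k * gconst (A $$ (k, i)))"

end

theory Submission
  imports Defs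
begin

text \<open>
  Since \<open>M\<close> is Manin, the elements \<open>\<theta>\<^sub>l = \<psi>\<^sup>M\<^sub>l\<close> anticommute. Put \<open>B\<^sub>j = \<Sum>\<^sub>l \<theta>\<^sub>l Y\<^sub>l\<^sub>j = \<psi>\<^sup>M\<^sup>Y\<^sub>j\<close> and \<open>q\<^sub>j = \<psi>\<^sup>Q\<^sub>j\<close>.
  The two conditions imply \<open>(B\<^sub>j + (c + 1) q\<^sub>j) \<theta>\<^sub>p = - \<theta>\<^sub>p (B\<^sub>j + c q\<^sub>j)\<close> for every scalar \<open>c\<close>,
  so \<open>B\<^sub>j + c q\<^sub>j\<close> moves through a product of \<open>c\<close> factors \<open>\<theta>\<close> and leaves \<open>B\<^sub>j\<close> behind. Hence the product
  of the elements \<open>B\<^sub>j + c q\<^sub>j\<close> for \<open>j = j\<^sub>1, \<dots>, j\<^sub>r\<close> and \<open>c = r - 1, \<dots>, 0\<close> is the sum of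
  \<open>\<theta>\<^sub>w\<^sub>1 \<dots> \<theta>\<^sub>w\<^sub>r Y\<^sub>w\<^sub>1\<^sub>j\<^sub>1 \<dots> Y\<^sub>w\<^sub>r\<^sub>j\<^sub>r\<close> over all words \<open>w\<close>, which anticommutativity turns into
  \<open>\<Sum>\<^sub>L \<theta>\<^sub>L det(Y\<^sub>L\<^sub>J)\<close>. Comparing the coefficients of \<open>\<psi>\<^sub>I\<close> gives (b), and (a) is a special case.
\<close>

section \<open>Products of anticommuting elements\<close>

lemma scaleC_minus_left: "(- c) *\<^sub>C x = - (c *\<^sub>C x)" for x :: "'a::complex_algebra_1"
  by (metis mult_minus1 scaleC_minus_one scaleC_scaleC)

lemma scaleC_minus_right: "c *\<^sub>C (- x) = - (c *\<^sub>C x)" for x :: "'a::complex_algebra_1"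
  by (metis mult.commute scaleC_minus_one scaleC_scaleC)

text \<open>The scalar 2 is invertible in a complex algebra, so an element equal to its negative
  vanishes. This yields both the zero squares of anticommuting elements and the cancellation in
  \<open>psi_mat_anticommute\<close>.\<close>

lemma eq_minus_self_imp_zero:
  fixes x :: "'a::complex_algebra_1"
  assumes "x = - x"
  shows "x = 0"
proof -
  have "(2::complex) *\<^sub>C x = x + x"
    using scaleC_add_left[of 1 1 x] by (simp add: scaleC_one)
  also have "x + x = 0" using assms by (metis add.right_inverse)
  finally have "(1/2::complex) *\<^sub>C (2::complex) *\<^sub>C x = 0" by simp
  then show ?thesis by (simp add: scaleC_scaleC scaleC_one)
qed

lemma anticommute_prod_list:
  fixes a :: "'a::complex_algebra_1"
  assumes "\<And>y. y \<in> set ys \<Longrightarrow> a * y = - (y * a)"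
  shows "a * prod_list ys = (- 1) ^ length ys *\<^sub>C (prod_list ys * a)"
  using assms
proof (induction ys)
  case Nil
  then show ?case by (simp add: scaleC_one)
next
  case (Cons y ys)
  have "a * prod_list (y # ys) = - (y * (a * prod_list ys))"
    using Cons.prems[of y] by (simp add: mult.assoc[symmetric])
  also have "\<dots> = - (y * ((- 1) ^ length ys *\<^sub>C (prod_list ys * a)))"
    using Cons by simp
  finally show ?case
    by (simp add: mult_scaleC_right mult.assoc scaleC_minus_left)
qed

text \<open>Move \<open>f j\<close> right past the block between positions \<open>i\<close> and
  \<open>j\<close>, exchange it with \<open>f i\<close>, and move \<open>f i\<close> left past the
  same block. The two block signs cancel, and only the sign of the single exchange remains.\<close>

lemma prod_list_transpose:
  fixes f :: "nat \<Rightarrow> 'a::complex_algebra_1"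
  assumes anti: "\<And>a b. a < r \<Longrightarrow> b < r \<Longrightarrow> f a * f b = - (f b * f a)"
    and ij: "i < j" "j < r"
  shows "prod_list (map (\<lambda>a. f (Transposition.transpose i j a)) [0..<r]) = - prod_list (map f [0..<r])"
proof -
  have split: "[0..<r] = [0..<i] @ i # [Suc i..<j] @ j # [Suc j..<r]"
  proof -
    have "[0..<r] = [0..<i] @ [i..<j] @ [j..<r]"
      using ij by (metis le_add_diff_inverse less_imp_le upt_add_eq_append zero_le append.assoc)
    then show ?thesis using ij by (simp add: upt_conv_Cons)
  qed
  let ?V = "map f [Suc i..<j]" and ?e = "(- 1 :: complex) ^ length (map f [Suc i..<j])"
  have i: "f i * prod_list ?V = ?e *\<^sub>C (prod_list ?V * f i)"
    by (rule anticommute_prod_list) (use ij in \<open>auto intro!: anti\<close>)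
  have j: "f j * prod_list ?V = ?e *\<^sub>C (prod_list ?V * f j)"
    by (rule anticommute_prod_list) (use ij in \<open>auto intro!: anti\<close>)
  have ji: "f j * f i = - (f i * f j)" by (rule anti) (use ij in auto)
  \<comment> \<open>The arbitrary right factor \<open>z\<close> stands for the rest of the product,
    since list products associate to the right.\<close>
  have "f j * (prod_list ?V * (f i * z)) = ?e *\<^sub>C (prod_list ?V * (f j * f i * z))" for z
    using arg_cong[OF j, of "\<lambda>u. u * (f i * z)"] by (simp only: mult_scaleC_left mult.assoc)
  also have "?e *\<^sub>C (prod_list ?V * (f j * f i * z)) = - (?e *\<^sub>C (prod_list ?V * (f i * (f j * z))))" for z
    by (simp add: ji scaleC_minus_right mult.assoc)
  also have "?e *\<^sub>C (prod_list ?V * (f i * (f j * z))) = f i * (prod_list ?V * (f j * z))" for z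
    using arg_cong[OF i, of "\<lambda>u. u * (f j * z)"] by (simp only: mult_scaleC_left mult.assoc)
  finally have key: "f j * (prod_list ?V * (f i * z)) = - (f i * (prod_list ?V * (f j * z)))" for z .
  let ?t = "\<lambda>a. f (Transposition.transpose i j a)"
  have t: "map ?t [0..<i] = map f [0..<i]" "map ?t [Suc i..<j] = ?V"
    "map ?t [Suc j..<r] = map f [Suc j..<r]"
    using ij by (auto simp: Transposition.transpose_def)
  show ?thesis
    unfolding split map_append list.map t by (simp add: key)
qed

lemma prod_list_permute:
  fixes f :: "nat \<Rightarrow> 'a::complex_algebra_1"
  assumes "\<sigma> permutes {..<r}"
    and "\<And>a b. a < r \<Longrightarrow> b < r \<Longrightarrow> f a * f b = - (f b * f a)"
  shows "prod_list (map (\<lambda>a. f (\<sigma> a)) [0..<r]) = of_int (sign \<sigma>) *\<^sub>C prod_list (map f [0..<r])"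
proof -
  \<comment> \<open>The quantifier over \<open>f\<close> lies inside the induction because the step
    applies the hypothesis to \<open>f\<close> composed with a transposition.\<close>
  have "\<forall>f::nat \<Rightarrow> 'a. (\<forall>a<r. \<forall>b<r. f a * f b = - (f b * f a)) \<longrightarrow>
    prod_list (map (\<lambda>a. f (\<sigma> a)) [0..<r]) = of_int (sign \<sigma>) *\<^sub>C prod_list (map f [0..<r])"
    using assms(1) finite_lessThan
  proof (induction rule: permutes_induct)
    case id
    then show ?case by (simp add: scaleC_one)
  next
    case (swap i j p)
    show ?case
    proof (intro allI impI)
      fix f :: "nat \<Rightarrow> 'a"
      assume f: "\<forall>a<r. \<forall>b<r. f a * f b = - (f b * f a)"
      let ?t = "\<lambda>a. f (Transposition.transpose i j a)"
      have t: "prod_list (map ?t [0..<r]) = - prod_list (map f [0..<r])"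
      proof (cases "i < j")
        case True
        then show ?thesis using swap.hyps by (intro prod_list_transpose f[rule_format]) auto
      next
        case False
        then have "j < i" using swap.hyps by simp
        then have "prod_list (map (\<lambda>a. f (Transposition.transpose j i a)) [0..<r])
            = - prod_list (map f [0..<r])"
          using swap.hyps by (intro prod_list_transpose f[rule_format]) auto
        then show ?thesis by (simp add: transpose_commute)
      qed
      have "\<forall>a<r. \<forall>b<r. ?t a * ?t b = - (?t b * ?t a)"
        using swap.hyps by (intro allI impI f[rule_format]) (auto simp: Transposition.transpose_def)
      then have "prod_list (map (\<lambda>a. ?t (p a)) [0..<r]) = of_int (sign p) *\<^sub>C prod_list (map ?t [0..<r])"
        by (rule swap.IH[THEN spec, THEN mp])
      moreover have "permutation p"
        by (rule permutes_imp_permutation[OF finite_lessThan]) (rule swap.hyps)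
      then have "sign (Transposition.transpose i j \<circ> p) = - sign p"
        using swap.hyps by (simp add: sign_compose sign_swap_id permutation_swap_id)
      ultimately show "prod_list (map (\<lambda>a. f ((Transposition.transpose i j \<circ> p) a)) [0..<r]) =
          of_int (sign (Transposition.transpose i j \<circ> p)) *\<^sub>C prod_list (map f [0..<r])"
        by (simp add: t scaleC_minus_left scaleC_minus_right)
    qed
  qed
  then show ?thesis
    by (elim allE[of _ f] mp) (intro allI impI assms(2))
qed

section \<open>Sums over words\<close>

abbreviation words :: "nat \<Rightarrow> nat \<Rightarrow> nat list set" where
  "words m r \<equiv> {w. set w \<subseteq> {..<m} \<and> length w = r}"

lemma sum_words_Suc:
  fixes F :: "nat list \<Rightarrow> 'b::comm_monoid_add"
  shows "(\<Sum>w\<in>words m (Suc r). F w) = (\<Sum>l<m. \<Sum>w\<in>words m r. F (l # w))"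
proof -
  have "(\<Sum>w\<in>words m (Suc r). F w) = (\<Sum>(w, l)\<in>words m r \<times> {..<m}. F (l # w))"
    unfolding lists_length_Suc_eq
    by (subst sum.reindex) (auto simp: inj_on_def case_prod_unfold)
  also have "\<dots> = (\<Sum>l<m. \<Sum>w\<in>words m r. F (l # w))"
    by (simp add: sum.cartesian_product[symmetric] sum.swap[of _ "{..<m}"])
  finally show ?thesis .
qed

lemma finite_increasing_indices: "finite (increasing_indices m r)"
  by (rule finite_subset[OF _ finite_lists_length_eq[of "{..<m}" r]])
    (auto simp: increasing_indices_def)

text \<open>A word with distinct letters arises from exactly one pair: its sorted version
  \<open>L\<close> and the permutation of positions, which is unique because the entries of
  \<open>L\<close> are distinct.\<close>

lemma sum_distinct_words:
  fixes F :: "nat list \<Rightarrow> 'b::comm_monoid_add"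
  shows "(\<Sum>w | w \<in> words m r \<and> distinct w. F w) =
    (\<Sum>L\<in>increasing_indices m r. \<Sum>\<sigma> | \<sigma> permutes {..<r}. F (permute_list \<sigma> L))"
proof -
  let ?P = "increasing_indices m r \<times> {\<sigma>. \<sigma> permutes {..<r}}"
  have inc: "length L = r" "sorted L" "distinct L" "set L \<subseteq> {..<m}"
    if "L \<in> increasing_indices m r" for L
    using that by (auto simp: increasing_indices_def strict_sorted_iff)
  have inj: "inj_on (\<lambda>(L, \<sigma>). permute_list \<sigma> L) ?P"
  proof (rule inj_onI, clarify)
    fix L \<sigma> L' \<sigma>'
    assume L: "L \<in> increasing_indices m r" and L': "L' \<in> increasing_indices m r"
      and \<sigma>: "\<sigma> permutes {..<r}" and \<sigma>': "\<sigma>' permutes {..<r}"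
      and eq: "permute_list \<sigma> L = permute_list \<sigma>' L'"
    have "mset L = mset L'"
      using eq mset_permute_list[of \<sigma> L] mset_permute_list[of \<sigma>' L'] \<sigma> \<sigma>' inc(1)[OF L] inc(1)[OF L']
      by metis
    then have LL: "L = L'"
      using inc(2)[OF L] inc(2)[OF L'] by (metis properties_for_sort)
    have "\<sigma> a = \<sigma>' a" for a
    proof (cases "a < r")
      case True
      then have "L ! \<sigma> a = L ! \<sigma>' a"
        using arg_cong[OF eq, of "\<lambda>w. w ! a"] LL inc(1)[OF L] \<sigma> \<sigma>'
        by (simp add: permute_list_nth)
      moreover have "\<sigma> a < r" "\<sigma>' a < r"
        using True permutes_in_image[OF \<sigma>] permutes_in_image[OF \<sigma>'] by auto
      ultimately show ?thesis using inc(1,3)[OF L] by (simp add: nth_eq_iff_index_eq)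
    next
      case False
      then show ?thesis using \<sigma> \<sigma>' by (simp add: permutes_not_in)
    qed
    then show "L = L' \<and> \<sigma> = \<sigma>'" using LL by auto
  qed
  have img: "(\<lambda>(L, \<sigma>). permute_list \<sigma> L) ` ?P = {w. w \<in> words m r \<and> distinct w}"
  proof (intro equalityI subsetI)
    fix w assume "w \<in> (\<lambda>(L, \<sigma>). permute_list \<sigma> L) ` ?P"
    then obtain L \<sigma> where L: "L \<in> increasing_indices m r" and \<sigma>: "\<sigma> permutes {..<r}"
      and w: "w = permute_list \<sigma> L" by auto
    have "mset w = mset L" using w \<sigma> inc(1)[OF L] by simp
    then show "w \<in> {w. w \<in> words m r \<and> distinct w}"
      using inc[OF L] mset_eq_imp_distinct_iff[of w L] mset_eq_length[of w L] mset_eq_setD[of w L]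
      by simp
  next
    fix w assume w: "w \<in> {w. w \<in> words m r \<and> distinct w}"
    then have L: "sort w \<in> increasing_indices m r"
      by (auto simp: increasing_indices_def strict_sorted_iff)
    obtain \<sigma> where "\<sigma> permutes {..<length (sort w)}" "permute_list \<sigma> (sort w) = w"
      using mset_eq_permutation[of w "sort w"] by auto
    then show "w \<in> (\<lambda>(L, \<sigma>). permute_list \<sigma> L) ` ?P"
      using L w by (auto intro!: image_eqI[of _ _ "(sort w, \<sigma>)"])
  qed
  show ?thesis
    unfolding img[symmetric] sum.reindex[OF inj]
    by (simp add: sum.cartesian_product case_prod_unfold)
qed

text \<open>Bring the first of two equal factors next to the second, at the cost of a sign. Its
  square is zero because it anticommutes with itself.\<close>

lemma prod_list_anticommute_not_distinct:
  fixes x :: "nat \<Rightarrow> 'a::complex_algebra_1"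
  assumes anti: "\<And>a b. a \<in> set w \<Longrightarrow> b \<in> set w \<Longrightarrow> x a * x b = - (x b * x a)"
    and "\<not> distinct w"
  shows "prod_list (map x w) = 0"
proof -
  obtain u v z a where w: "w = u @ [a] @ v @ [a] @ z"
    using not_distinct_decomp assms(2) by blast
  have a: "x a * x a = 0"
    by (rule eq_minus_self_imp_zero, rule anti) (simp_all add: w)
  have "x a * prod_list (map x v) = (- 1) ^ length (map x v) *\<^sub>C (prod_list (map x v) * x a)"
    by (rule anticommute_prod_list) (auto simp: w intro!: anti)
  then have "x a * prod_list (map x v) * x a = (- 1) ^ length v *\<^sub>C (prod_list (map x v) * (x a * x a))"
    by (simp add: mult_scaleC_left mult.assoc)
  then have "x a * prod_list (map x v) * x a = 0" by (simp add: a)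
  then have "x a * (prod_list (map x v) * (x a * y)) = 0" for y
    by (metis mult.assoc mult_zero_left)
  then show ?thesis by (simp add: w)
qed

lemma gconst_sum: "gconst (\<Sum>i\<in>A. f i) = (\<Sum>i\<in>A. gconst (f i :: 'a::ab_group_add))"
  by (rule grassmann_eqI) (simp add: gconst_def gcoeff_gmonom)

text \<open>One monomial of a column determinant, with row word \<open>w\<close> and column word
  \<open>J\<close>. The order of the factors follows the lists, as the entries need not
  commute.\<close>

definition entry_prod :: "'a::complex_algebra_1 mat \<Rightarrow> nat list \<Rightarrow> nat list \<Rightarrow> 'a" where
  "entry_prod A w J = prod_list (map2 (\<lambda>l j. A $$ (l, j)) w J)"

lemma entry_prod_Nil [simp]: "entry_prod A [] J = 1"
  by (simp add: entry_prod_def)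

lemma entry_prod_Cons [simp]: "entry_prod A (l # w) (j # J) = A $$ (l, j) * entry_prod A w J"
  by (simp add: entry_prod_def)

lemma det_col_mat_select:
  assumes "length L = length J"
  shows "det_col (mat_select A L J) =
    (\<Sum>\<sigma> | \<sigma> permutes {..<length J}. of_int (sign \<sigma>) *\<^sub>C entry_prod A (permute_list \<sigma> L) J)"
proof -
  have "map (\<lambda>j. mat_select A L J $$ (\<sigma> j, j)) [0..<length J] =
      map2 (\<lambda>l j. A $$ (l, j)) (permute_list \<sigma> L) J" if \<sigma>: "\<sigma> permutes {..<length J}" for \<sigma>
  proof (rule nth_equalityI)
    fix a assume "a < length (map (\<lambda>j. mat_select A L J $$ (\<sigma> j, j)) [0..<length J])"
    then have "a < length J" by simp
    moreover from this have "\<sigma> a < length J" using permutes_in_image[OF \<sigma>] by auto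
    ultimately show "map (\<lambda>j. mat_select A L J $$ (\<sigma> j, j)) [0..<length J] ! a =
        map2 (\<lambda>l j. A $$ (l, j)) (permute_list \<sigma> L) J ! a"
      using \<sigma> assms by (simp add: mat_select_def permute_list_nth)
  qed (simp add: assms)
  moreover have "dim_row (mat_select A L J) = length J" by (simp add: mat_select_def assms)
  ultimately show ?thesis
    by (simp add: det_col_def entry_prod_def)
qed

text \<open>Words with a repeated letter contribute zero. Grouping the others by their sorted
  version \<open>L\<close>, the sign from reordering the \<open>x\<close> factors becomes the sign
  in the determinant. The elements \<open>x\<close> stay abstract because both \<open>psi\<close>
  and \<open>psi_mat M\<close> are substituted for them.\<close>

lemma sum_words_eq_det_col:
  fixes x :: "nat \<Rightarrow> 'a::complex_algebra_1 grassmann" and A :: "'a mat"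
  assumes anti: "\<And>a b. a < m \<Longrightarrow> b < m \<Longrightarrow> x a * x b = - (x b * x a)"
    and r: "length J = r"
  shows "(\<Sum>w\<in>words m r. prod_list (map x w) * gconst (entry_prod A w J)) =
    (\<Sum>L\<in>increasing_indices m r. prod_list (map x L) * gconst (det_col (mat_select A L J)))"
proof -
  let ?F = "\<lambda>w. prod_list (map x w) * gconst (entry_prod A w J)"
  have "(\<Sum>w\<in>words m r. ?F w) = (\<Sum>w | w \<in> words m r \<and> distinct w. ?F w)"
  proof (rule sum.mono_neutral_right)
    show "\<forall>w\<in>words m r - {w \<in> words m r. distinct w}. ?F w = 0"
    proof
      fix w assume "w \<in> words m r - {w \<in> words m r. distinct w}"
      then have "prod_list (map x w) = 0"
        by (intro prod_list_anticommute_not_distinct anti) auto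
      then show "?F w = 0" by simp
    qed
  qed (use finite_lists_length_eq[of "{..<m}" r] in auto)
  also have "\<dots> = (\<Sum>L\<in>increasing_indices m r. \<Sum>\<sigma> | \<sigma> permutes {..<r}. ?F (permute_list \<sigma> L))"
    by (rule sum_distinct_words)
  also have "\<dots> = (\<Sum>L\<in>increasing_indices m r. prod_list (map x L) * gconst (det_col (mat_select A L J)))"
  proof (rule sum.cong[OF refl])
    fix L assume "L \<in> increasing_indices m r"
    then have L: "length L = r" "set L \<subseteq> {..<m}" by (auto simp: increasing_indices_def)
    have "prod_list (map x (permute_list \<sigma> L)) = of_int (sign \<sigma>) *\<^sub>C prod_list (map x L)"
      if \<sigma>: "\<sigma> permutes {..<r}" for \<sigma>
    proof -
      have "prod_list (map (\<lambda>a. x (L ! \<sigma> a)) [0..<r]) =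
          of_int (sign \<sigma>) *\<^sub>C prod_list (map (\<lambda>a. x (L ! a)) [0..<r])"
        using L by (intro prod_list_permute[OF \<sigma>] anti) (auto simp: subset_iff)
      moreover have "map x L = map (\<lambda>a. x (L ! a)) [0..<r]"
        using L by (intro nth_equalityI) auto
      ultimately show ?thesis using L by (simp add: permute_list_def comp_def)
    qed
    then show "(\<Sum>\<sigma> | \<sigma> permutes {..<r}. ?F (permute_list \<sigma> L)) =
        prod_list (map x L) * gconst (det_col (mat_select A L J))"
      using L r by (simp add: det_col_mat_select gconst_sum gconst_scaleC sum_distrib_left
          mult_scaleC_left mult_scaleC_right)
  qed
  finally show ?thesis .
qed

section \<open>Column determinants as coefficients\<close>

lemma gconst_commute_prod_psi:
  "gconst a * prod_list (map psi w) = prod_list (map psi w) * gconst a"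
proof (induction w)
  case (Cons k w)
  have "gconst a * prod_list (map psi (k # w)) = psi k * (gconst a * prod_list (map psi w))"
    by (simp add: mult.assoc[symmetric] psi_commute_gconst)
  then show ?case by (simp add: Cons mult.assoc)
qed simp

text \<open>The Grassmann variables commute with constants, so they collect on the left while the
  matrix entries keep their order.\<close>

lemma prod_psi_mat:
  assumes "dim_row A = n"
  shows "prod_list (map (psi_mat A) J) =
    (\<Sum>w\<in>words n (length J). prod_list (map psi w) * gconst (entry_prod A w J))"
proof (induction J)
  case Nil
  have "words n 0 = {[]}" by auto
  then show ?case by (simp add: gconst_one)
next
  case (Cons j J)
  have swap: "psi l * gconst (A $$ (l, j)) * (prod_list (map psi w) * gconst (entry_prod A w J)) =
      psi l * prod_list (map psi w) * (gconst (A $$ (l, j)) * gconst (entry_prod A w J))" for l w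
    using arg_cong[OF gconst_commute_prod_psi[of "A $$ (l, j)" w],
        of "\<lambda>u. psi l * u * gconst (entry_prod A w J)"] by (simp only: mult.assoc)
  have "prod_list (map (psi_mat A) (j # J)) = psi_mat A j *
      (\<Sum>w\<in>words n (length J). prod_list (map psi w) * gconst (entry_prod A w J))"
    by (simp only: list.map prod_list.Cons Cons)
  also have "\<dots> = (\<Sum>l<n. \<Sum>w\<in>words n (length J).
      psi l * gconst (A $$ (l, j)) * (prod_list (map psi w) * gconst (entry_prod A w J)))"
    by (simp only: psi_mat_def assms sum_product)
  finally show ?case
    unfolding swap by (simp add: sum_words_Suc gconst_mult mult.assoc del: mem_Collect_eq)
qed

text \<open>An increasing list is determined by its set of entries, so different lists give
  different basis monomials.\<close>

lemma gcoeff_prod_psi: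
  fixes c :: "'a::complex_algebra_1"
  assumes "I \<in> increasing_indices n r" "I' \<in> increasing_indices n r"
  shows "gcoeff (prod_list (map psi I') * gconst c) (set I) = (if I' = I then c else 0)"
proof -
  have s: "sorted_list_of_set (set K) = K" if "K \<in> increasing_indices n r" for K
    using that by (simp add: increasing_indices_def strict_sorted_iff
        sorted_list_of_set.idem_if_sorted_distinct)
  have "prod_list (map psi I') * gconst c = gmonom c (set I')"
    using s[OF assms(2)] by (simp add: gmonom_eq_prod_psi gconst_commute_prod_psi)
  then show ?thesis
    using s[OF assms(1)] s[OF assms(2)] by (auto simp: gcoeff_gmonom)
qed

text \<open>Rests on the anticommutativity of the \<open>psi\<close> alone, so it serves both for
  the minors of \<open>M\<close> and for the corrected product on the left-hand side of the
  theorem.\<close>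

lemma gcoeff_prod_psi_mat:
  assumes "I \<in> increasing_indices (dim_row A) (length J)"
  shows "gcoeff (prod_list (map (psi_mat A) J)) (set I) = det_col (mat_select A I J)"
  using assms finite_increasing_indices[of "dim_row A" "length J"]
  by (simp add: prod_psi_mat[OF refl] sum_words_eq_det_col[OF psi_anticommute refl] gcoeff_prod_psi
      del: mem_Collect_eq cong: sum.cong)

lemma gcoeff_times_gconst:
  fixes c :: "'a::complex_algebra_1"
  assumes "finite S"
  shows "gcoeff (x * gconst c) S = gcoeff x S * c"
proof -
  have "gcoeff (x * gconst c) S = (\<Sum>A\<in>Pow S. if A = S then gcoeff x S * c else 0)"
    unfolding gcoeff_times
    by (rule sum.cong) (auto simp: gconst_def gcoeff_gmonom scaleC_one)
  then show ?thesis using assms by simp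
qed

section \<open>The Capelli-type identity\<close>

text \<open>In the anticommutator, the factor \<open>psi k * psi l\<close> has coefficient
  \<open>c k l\<close>. The Manin relation for commutators says that \<open>c\<close> is symmetric,
  while the product of the \<open>psi\<close> is antisymmetric, so the double sum equals its own
  negative.\<close>

lemma psi_mat_anticommute:
  assumes "manin_matrix M" "i < dim_col M" "j < dim_col M"
  shows "psi_mat M i * psi_mat M j = - (psi_mat M j * psi_mat M i)"
proof -
  let ?n = "dim_row M"
  define c where "c k l = M $$ (k, i) * M $$ (l, j) + M $$ (k, j) * M $$ (l, i)" for k l
  have c: "c k l = c l k" if "k < ?n" "l < ?n" for k l
  proof -
    have "commutator (M $$ (k, i)) (M $$ (l, j)) = commutator (M $$ (l, i)) (M $$ (k, j))"
      using assms that by (auto simp: manin_matrix_def)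
    then show ?thesis by (simp add: c_def commutator_def algebra_simps)
  qed
  have prod: "psi_mat M a * psi_mat M b =
      (\<Sum>k<?n. \<Sum>l<?n. psi k * psi l * gconst (M $$ (k, a) * M $$ (l, b)))" for a b
  proof -
    have "psi k * gconst u * (psi l * gconst v) = psi k * psi l * gconst (u * v)" for k l and u v :: 'a
      using arg_cong[OF psi_commute_gconst[of l u], of "\<lambda>z. psi k * z * gconst v"]
      by (simp only: gconst_mult mult.assoc)
    then show ?thesis by (simp add: psi_mat_def sum_product)
  qed
  let ?S = "\<Sum>k<?n. \<Sum>l<?n. psi k * psi l * gconst (c k l)"
  have "?S = (\<Sum>l<?n. \<Sum>k<?n. psi k * psi l * gconst (c k l))"
    by (rule sum.swap)
  also have "\<dots> = (\<Sum>l<?n. \<Sum>k<?n. - (psi l * psi k * gconst (c l k)))"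
  proof (intro sum.cong refl)
    fix l k assume "l \<in> {..<?n}" "k \<in> {..<?n}"
    then show "psi k * psi l * gconst (c k l) = - (psi l * psi k * gconst (c l k))"
      using c[of k l] arg_cong[OF psi_anticommute[of k l], of "\<lambda>z. z * gconst (c k l)"] by simp
  qed
  also have "\<dots> = - ?S" by (simp add: sum_negf)
  finally have "?S = 0" by (rule eq_minus_self_imp_zero)
  moreover have "psi_mat M i * psi_mat M j + psi_mat M j * psi_mat M i = ?S"
    by (simp add: prod c_def gconst_add sum.distrib distrib_left)
  ultimately show ?thesis by (simp add: eq_neg_iff_add_eq_0)
qed

lemma psi_mat_mult:
  assumes "M \<in> carrier_mat n m" "Y \<in> carrier_mat m s" "j < s"
  shows "psi_mat (M * Y) j = (\<Sum>l<m. psi_mat M l * gconst (Y $$ (l, j)))"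
proof -
  have "psi_mat (M * Y) j = (\<Sum>k<n. \<Sum>l<m. psi k * gconst (M $$ (k, l)) * gconst (Y $$ (l, j)))"
    using assms by (auto simp: psi_mat_def scalar_prod_def gconst_sum gconst_mult sum_distrib_left
        mult.assoc lessThan_atLeast0 intro!: sum.cong)
  also have "\<dots> = (\<Sum>l<m. psi_mat M l * gconst (Y $$ (l, j)))"
    using assms by (subst sum.swap) (simp add: psi_mat_def sum_distrib_right)
  finally show ?thesis .
qed

text \<open>
  The abstract form of the key identity: \<open>B j\<close> and \<open>q j\<close> stand for \<open>\<psi>\<^sup>M\<^sup>Y\<^sub>j\<close> and \<open>\<psi>\<^sup>Q\<^sub>j\<close>, and the first
  hypothesis combines the two conditions of the theorem at \<open>c = 0\<close>.
\<close>

lemma prod_shifted_eq_sum_words: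
  fixes x B q :: "nat \<Rightarrow> 'a::complex_algebra_1 grassmann" and Y :: "'a mat"
  assumes move: "\<And>p j. p < m \<Longrightarrow> j < s \<Longrightarrow> (B j + q j) * x p = - (x p * B j)"
    and qx: "\<And>p j. p < m \<Longrightarrow> j < s \<Longrightarrow> q j * x p = - (x p * q j)"
    and anti: "\<And>a b. a < m \<Longrightarrow> b < m \<Longrightarrow> x a * x b = - (x b * x a)"
    and B: "\<And>j. j < s \<Longrightarrow> B j = (\<Sum>l<m. x l * gconst (Y $$ (l, j)))"
    and J: "set J \<subseteq> {..<s}"
  shows "prod_list (map (\<lambda>a. B (J ! a) + of_nat (length J - 1 - a) *\<^sub>C q (J ! a)) [0..<length J]) =
    (\<Sum>w\<in>words m (length J). prod_list (map x w) * gconst (entry_prod Y w J))"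
  using J
proof (induction J)
  case Nil
  have "words m 0 = {[]}" by auto
  then show ?case by (simp add: gconst_one)
next
  case (Cons j J)
  let ?X = "\<lambda>w. prod_list (map x w)" and ?E = "\<lambda>c. B j + of_nat c *\<^sub>C q j"
  let ?e = "(- 1 :: complex) ^ length J"
  have j: "j < s" using Cons.prems by simp
  \<comment> \<open>Adding \<open>c\<close> times \<open>qx\<close> to \<open>move\<close>: passing
    one factor \<open>x p\<close> lowers the coefficient of \<open>q j\<close> by one.\<close>
  have step: "?E (Suc c) * x p = - (x p * ?E c)" if "p < m" for c p
  proof -
    have "?E (Suc c) * x p = (B j + q j) * x p + of_nat c *\<^sub>C (q j * x p)"
      by (simp add: scaleC_add_left scaleC_one algebra_simps mult_scaleC_left)
    also have "\<dots> = - (x p * B j) + of_nat c *\<^sub>C - (x p * q j)"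
      by (simp only: move[OF that j] qx[OF that j])
    finally show ?thesis
      by (simp add: distrib_left scaleC_minus_right mult_scaleC_right)
  qed
  \<comment> \<open>Each letter of \<open>w\<close> uses up one copy of \<open>q j\<close>, so a
    shift by exactly \<open>length w\<close> leaves the bare \<open>B j\<close> on the right. This
    explains the diagonal entries of the correction.\<close>
  have through: "?E (length w) * ?X w = (- 1) ^ length w *\<^sub>C (?X w * B j)"
    if "set w \<subseteq> {..<m}" for w
    using that
  proof (induction w)
    case Nil
    then show ?case by (simp add: scaleC_one)
  next
    case (Cons p w)
    then have p: "p < m" and IH: "?E (length w) * ?X w = (- 1) ^ length w *\<^sub>C (?X w * B j)"
      by simp_all
    have "?E (length (p # w)) * ?X (p # w) = - (x p * (?E (length w) * ?X w))"
      using step[OF p, of "length w"] by (simp add: mult.assoc[symmetric] del: of_nat_Suc)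
    then show ?case
      unfolding IH by (simp add: mult_scaleC_right mult.assoc scaleC_minus_left)
  qed
  \<comment> \<open>After \<open>B j\<close> is expanded, \<open>x l\<close> travels back to the
    front of \<open>?X w\<close> with the same sign as \<open>?E\<close> acquired, so the signs
    cancel. The new entry \<open>Y $$ (l, j)\<close> stays to the left of those of \<open>w\<close>,
    as \<open>entry_prod\<close> requires.\<close>
  have word: "?E (length J) * (?X w * gconst (entry_prod Y w J)) =
      (\<Sum>l<m. ?X (l # w) * gconst (entry_prod Y (l # w) (j # J)))" if w: "w \<in> words m (length J)" for w
  proof -
    have "?E (length J) * ?X w = ?e *\<^sub>C (?X w * B j)"
      using through[of w] w by auto
    also have "\<dots> = (\<Sum>l<m. ?e *\<^sub>C (?X w * x l) * gconst (Y $$ (l, j)))"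
      by (simp add: B[OF j] sum_distrib_left scaleC_sum_right mult_scaleC_left mult.assoc)
    also have "\<dots> = (\<Sum>l<m. x l * ?X w * gconst (Y $$ (l, j)))"
    proof (rule sum.cong[OF refl])
      fix l assume l: "l \<in> {..<m}"
      have "x l * ?X w = (- 1) ^ length (map x w) *\<^sub>C (?X w * x l)"
        using w l by (intro anticommute_prod_list) (auto intro!: anti)
      then show "?e *\<^sub>C (?X w * x l) * gconst (Y $$ (l, j)) = x l * ?X w * gconst (Y $$ (l, j))"
        using w by simp
    qed
    finally show ?thesis
      by (simp add: mult.assoc[symmetric] sum_distrib_right gconst_mult)
  qed
  \<comment> \<open>The head has position 0 and so coefficient \<open>length J\<close>; shifting
    positions by one turns the remaining coefficients into those belonging to
    \<open>J\<close>.\<close>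
  have "prod_list (map (\<lambda>a. B ((j # J) ! a) + of_nat (length (j # J) - 1 - a) *\<^sub>C q ((j # J) ! a))
      [0..<length (j # J)]) =
    ?E (length J) * prod_list (map (\<lambda>a. B (J ! a) + of_nat (length J - 1 - a) *\<^sub>C q (J ! a)) [0..<length J])"
    by (simp add: upt_conv_Cons map_Suc_upt[symmetric] comp_def del: upt_Suc)
  also have "\<dots> = (\<Sum>w\<in>words m (length J). ?E (length J) * (?X w * gconst (entry_prod Y w J)))"
    using Cons by (simp add: sum_distrib_left)
  also have "\<dots> = (\<Sum>w\<in>words m (length J). \<Sum>l<m. ?X (l # w) * gconst (entry_prod Y (l # w) (j # J)))"
    using word by (rule sum.cong[OF refl])
  also have "\<dots> = (\<Sum>w\<in>words m (length (j # J)). ?X w * gconst (entry_prod Y w (j # J)))"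
    by (simp only: length_Cons sum_words_Suc sum.swap[of _ "{..<m}"])
  finally show ?case .
qed

section \<open>Full index sets and the diagonal correction\<close>

lemma increasing_indices_full: "increasing_indices n n = {[0..<n]}"
proof (intro equalityI subsetI)
  fix L assume "L \<in> increasing_indices n n"
  then have L: "length L = n" "sorted L" "distinct L" "set L \<subseteq> {..<n}"
    by (auto simp: increasing_indices_def strict_sorted_iff)
  then have "set L = {..<n}"
    by (metis card_lessThan card_subset_eq distinct_card finite_lessThan)
  then show "L \<in> {[0..<n]}"
    using L sorted_distinct_set_unique[of L "[0..<n]"] by (auto simp: lessThan_atLeast0)
qed (auto simp: increasing_indices_def)

lemma mat_select_full:
  assumes "A \<in> carrier_mat n n"
  shows "mat_select A [0..<n] [0..<n] = A"
  using assms by (intro eq_matI) (auto simp: mat_select_def)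

lemma mult_desc_diag_index:
  fixes A :: "'a::complex_algebra_1 mat"
  assumes "A \<in> carrier_mat n r" "i < n" "a < r"
  shows "(A * desc_diag r) $$ (i, a) = of_nat (r - 1 - a) *\<^sub>C A $$ (i, a)"
proof -
  have "(A * desc_diag r) $$ (i, a) = (\<Sum>l<r. A $$ (i, l) * desc_diag r $$ (l, a))"
    using assms by (auto simp: scalar_prod_def desc_diag_def mat_diag_def lessThan_atLeast0)
  also have "\<dots> = (\<Sum>l<r. if l = a then of_nat (r - 1 - a) *\<^sub>C A $$ (i, a) else 0)"
    using assms by (intro sum.cong) (auto simp: desc_diag_def mat_diag_def mult_scaleC_right)
  finally show ?thesis using assms by simp
qed

theorem theorem6:
  fixes M Y Q :: "'a::complex_algebra_1 mat" and n m s :: nat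
  assumes "M \<in> carrier_mat n m" and "Y \<in> carrier_mat m s" and "Q \<in> carrier_mat n s"
    and "manin_matrix M"
    and condition1: "\<And>p j. p < m \<Longrightarrow> j < s \<Longrightarrow>
      (\<Sum>l<m. psi_mat M l * commutator (gconst (Y $$ (l, j))) (psi_mat M p)) =
        psi_mat M p * psi_mat Q j"
    and condition2: "\<And>i j. i < m \<Longrightarrow> j < s \<Longrightarrow>
      psi_mat M i * psi_mat Q j = - (psi_mat Q j * psi_mat M i)"
  shows "(n = m \<and> m = s \<longrightarrow> det_col (M * Y + Q * desc_diag n) = det_col M * det_col Y) \<and>
    (\<forall>r I J. r \<le> n \<longrightarrow> r \<le> s \<longrightarrow>
      I \<in> increasing_indices n r \<longrightarrow> length J = r \<longrightarrow> set J \<subseteq> {..<s} \<longrightarrow>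
      det_col (mat_select (M * Y) I J + mat_select Q I J * desc_diag r) =
        (\<Sum>L\<in>increasing_indices m r. det_col (mat_select M I L) * det_col (mat_select Y L J)))"
proof -
  let ?x = "psi_mat M" and ?B = "psi_mat (M * Y)" and ?q = "psi_mat Q"
  have anti: "?x a * ?x b = - (?x b * ?x a)" if "a < m" "b < m" for a b
    by (rule psi_mat_anticommute) (use assms(1,4) that in auto)
  have B: "?B j = (\<Sum>l<m. ?x l * gconst (Y $$ (l, j)))" if "j < s" for j
    using psi_mat_mult assms(1,2) that by blast
  have qx: "?q j * ?x p = - (?x p * ?q j)" if "p < m" "j < s" for p j
    using condition2[OF that] by simp
  \<comment> \<open>Commute \<open>?x p\<close> past the entry of \<open>Y\<close> and then
    anticommute it past \<open>?x l\<close>. Summed over \<open>l\<close>, the commutators give the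
    left side of condition 1, hence \<open>?x p * ?q j\<close>, which condition 2 cancels against
    \<open>?q j * ?x p\<close>.\<close>
  have move: "(?B j + ?q j) * ?x p = - (?x p * ?B j)" if p: "p < m" and j: "j < s" for p j
  proof -
    have "?x l * gconst (Y $$ (l, j)) * ?x p =
        ?x l * commutator (gconst (Y $$ (l, j))) (?x p) - ?x p * (?x l * gconst (Y $$ (l, j)))"
      if "l < m" for l
    proof -
      have "?x l * (?x p * z) = - (?x p * (?x l * z))" for z
        using arg_cong[OF anti[OF that p], of "\<lambda>u. u * z"] by (simp add: mult.assoc)
      then show ?thesis by (simp add: commutator_def right_diff_distrib mult.assoc)
    qed
    then have "?B j * ?x p = ?x p * ?q j - ?x p * ?B j"
      unfolding B[OF j] condition1[OF p j, symmetric]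
      by (simp add: sum_distrib_left sum_distrib_right sum_subtractf)
    then show ?thesis using qx[OF p j] by (simp add: distrib_right)
  qed
  have b: "det_col (mat_select (M * Y) I J + mat_select Q I J * desc_diag r) =
        (\<Sum>L\<in>increasing_indices m r. det_col (mat_select M I L) * det_col (mat_select Y L J))"
    if I: "I \<in> increasing_indices n r" and r: "length J = r" and J: "set J \<subseteq> {..<s}" for r I J
  proof -
    \<comment> \<open>All \<open>n\<close> rows are kept and only the columns are selected, so that
      \<open>psi_mat A a\<close> is the shifted element
      \<open>?B (J ! a) + of_nat (r - 1 - a) *\<^sub>C ?q (J ! a)\<close>. The shift depends on the
      position \<open>a\<close>, not on the value \<open>J ! a\<close>; the rows \<open>I\<close>
      enter when the coefficient is read off.\<close>
    define A where "A = mat n r (\<lambda>(k, a). (M * Y) $$ (k, J ! a) + of_nat (r - 1 - a) *\<^sub>C Q $$ (k, J ! a))"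
    have Ilt: "length I = r" "\<And>a. a < r \<Longrightarrow> I ! a < n"
      using I nth_mem by (fastforce simp: increasing_indices_def)+
    have "mat_select (M * Y) I J + mat_select Q I J * desc_diag r = mat_select A I [0..<r]"
    proof (rule eq_matI)
      fix i a assume "i < dim_row (mat_select A I [0..<r])" "a < dim_col (mat_select A I [0..<r])"
      then have ia: "i < r" "a < r" using Ilt by (simp_all add: mat_select_def)
      have "mat_select Q I J \<in> carrier_mat r r" using Ilt r by (simp add: mat_select_def)
      note d = mult_desc_diag_index[OF this ia]
      have "(mat_select (M * Y) I J + mat_select Q I J * desc_diag r) $$ (i, a) =
          mat_select (M * Y) I J $$ (i, a) + (mat_select Q I J * desc_diag r) $$ (i, a)"
        using ia Ilt by (intro index_add_mat) (simp_all add: mat_select_def desc_diag_def mat_diag_def)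
      then show "(mat_select (M * Y) I J + mat_select Q I J * desc_diag r) $$ (i, a) =
          mat_select A I [0..<r] $$ (i, a)"
        unfolding d using ia Ilt r by (simp add: mat_select_def A_def)
    qed (use Ilt in \<open>simp_all add: mat_select_def desc_diag_def mat_diag_def\<close>)
    then have "det_col (mat_select (M * Y) I J + mat_select Q I J * desc_diag r) =
        gcoeff (prod_list (map (psi_mat A) [0..<r])) (set I)"
      using gcoeff_prod_psi_mat[of I A "[0..<r]"] I by (simp add: A_def)
    also have "map (psi_mat A) [0..<r] =
        map (\<lambda>a. ?B (J ! a) + of_nat (length J - 1 - a) *\<^sub>C ?q (J ! a)) [0..<length J]"
      using assms(1,3) r
      by (simp add: A_def psi_mat_def gconst_add gconst_scaleC distrib_left sum.distrib
          mult_scaleC_right scaleC_sum_right)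
    also have "prod_list \<dots> =
        (\<Sum>L\<in>increasing_indices m r. prod_list (map ?x L) * gconst (det_col (mat_select Y L J)))"
      using prod_shifted_eq_sum_words[OF move qx anti B J]
        sum_words_eq_det_col[OF anti r, where A = Y] r by simp
    also have "gcoeff \<dots> (set I) =
        (\<Sum>L\<in>increasing_indices m r. det_col (mat_select M I L) * det_col (mat_select Y L J))"
      unfolding gcoeff_sum
    proof (rule sum.cong[OF refl])
      fix L assume "L \<in> increasing_indices m r"
      then have "gcoeff (prod_list (map ?x L)) (set I) = det_col (mat_select M I L)"
        using I assms(1) by (intro gcoeff_prod_psi_mat) (auto simp: increasing_indices_def)
      then show "gcoeff (prod_list (map ?x L) * gconst (det_col (mat_select Y L J))) (set I) =
          det_col (mat_select M I L) * det_col (mat_select Y L J)"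
        by (simp add: gcoeff_times_gconst)
    qed
    finally show ?thesis .
  qed
  \<comment> \<open>For square matrices \<open>[0..<n]\<close> is the only increasing list of length
    \<open>n\<close>, so the sum over \<open>L\<close> has one term and each selection is the whole
    matrix.\<close>
  have "det_col (M * Y + Q * desc_diag n) = det_col M * det_col Y" if "n = m" "m = s"
    using b[of "[0..<n]" n "[0..<n]"] assms(1-3) that
    by (simp add: increasing_indices_full mat_select_full lessThan_atLeast0)
  then show ?thesis using b by blast
qed

end
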